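(* Let $F,G:\mathbb R^4\to\mathbb R$ be a pair of differentiable functions and suppose that $M\subset\mathbb R^4$ is a surface defined as the transversal intersection of the inverse images of a regular value of $F$ and a regular value of $G$. Let $\nu$ and $\mu$ be the gradient vector fields of $F$ and $G$, respectively. Assume that $V_1,V_2$ is a frame of the tangent bundle of $M$. Then the differential equation of the $\nu$-lines of curvature of $M$ has the expression $$l_1^2\,\Omega_{11}+l_1l_2\,(\Omega_{12}+\Omega_{21})+l_2^2\,\Omega_{22}=0,$$ where $\Omega_{ij}=\langle\bar\nabla_{V_i}\nu\wedge V_j\wedge\mu,\ \nu\rangle$ for $i,j\in\{1,2\}$ and $l_i$ is the $i$-th component of the vectorial solution $X=l_1V_1+l_2V_2$ of the equation. That is, $X=l_1V_1+l_2V_2\in T_pM$ is tangent to a $\nu$-principal direction at $p$ if and only if this equation holds at $p$.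
   Context: "Differentiable" means smooth. $\bar\nabla$ is the Riemannian connection (directional derivative) of $\mathbb R^4$, and for $a,b,c\in\mathbb R^4$, $a\wedge b\wedge c\in\mathbb R^4$ is the triple vector product, so that $\langle a\wedge b\wedge c,d\rangle=\det(a,b,c,d)$ (up to a universal sign). For a unit normal field $\tilde\nu$ on a surface $M\subset\mathbb R^4$, the $\tilde\nu$-shape operator is $S_{\tilde\nu}(X)=-(\bar\nabla_X\tilde\nu)^\top$ on $T_pM$ ($\top$ = tangential component); a vector $X\in T_pM$ is tangent to a $\tilde\nu$-principal direction if $S_{\tilde\nu}(X)=\lambda X$ for some $\lambda\in\mathbb R$, and the $\tilde\nu$-lines of curvature are the integral curves of these directions. For a nowhere zero, not necessarily unit normal field $\nu$, the $\nu$-principal directions and $\nu$-lines of curvature are those of $\tilde\nu=\nu/\|\nu\|$. *)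

theory Defs
  imports "HOL-Analysis.Analysis"
begin

text \<open>Smoothness. On an open set of a Euclidean space, \<open>C\<^sup>k\<close> is defined by iterating
  directional derivatives. On an arbitrary set (such as a surface), a map is smooth if it
  locally extends to a smooth map on an open set; on open sets the two notions agree.\<close>

primrec Ck_on_open :: "nat \<Rightarrow> 'a::euclidean_space set \<Rightarrow> ('a \<Rightarrow> 'b::real_normed_vector) \<Rightarrow> bool" where
  "Ck_on_open 0 U f \<longleftrightarrow> continuous_on U f"
| "Ck_on_open (Suc k) U f \<longleftrightarrow> (\<forall>x\<in>U. f differentiable at x) \<and>
     (\<forall>v. Ck_on_open k U (\<lambda>x. frechet_derivative f (at x) v))"

definition smooth_on :: "'a::euclidean_space set \<Rightarrow> ('a \<Rightarrow> 'b::real_normed_vector) \<Rightarrow> bool" where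
  "smooth_on S f \<longleftrightarrow> (\<forall>p\<in>S. \<exists>U g. open U \<and> p \<in> U \<and> (\<forall>k. Ck_on_open k U g) \<and>
     (\<forall>x\<in>S \<inter> U. g x = f x))"

definition regular_value :: "('a::euclidean_space \<Rightarrow> real) \<Rightarrow> real \<Rightarrow> bool" where
  "regular_value F a \<longleftrightarrow> (\<forall>p. F p = a \<longrightarrow> surj (frechet_derivative F (at p)))"

definition tangent_space :: "'a::euclidean_space set \<Rightarrow> 'a \<Rightarrow> 'a set" where
  "tangent_space M p = {v. \<exists>\<epsilon>>0. \<exists>\<gamma>. smooth_on {-\<epsilon><..<\<epsilon>} \<gamma> \<and> \<gamma> ` {-\<epsilon><..<\<epsilon>} \<subseteq> M \<and>
     \<gamma> 0 = p \<and> (\<gamma> has_vector_derivative v) (at 0)}"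

definition transversal :: "'a::euclidean_space set \<Rightarrow> 'a set \<Rightarrow> bool" where
  "transversal A B \<longleftrightarrow>
     (\<forall>p\<in>A \<inter> B. {u + v | u v. u \<in> tangent_space A p \<and> v \<in> tangent_space B p} = UNIV)"

definition tangent_frame :: "'a::euclidean_space set \<Rightarrow> ('a \<Rightarrow> 'a) \<Rightarrow> ('a \<Rightarrow> 'a) \<Rightarrow> bool" where
  "tangent_frame M V1 V2 \<longleftrightarrow> smooth_on M V1 \<and> smooth_on M V2 \<and>
     (\<forall>p\<in>M. V1 p \<noteq> V2 p \<and> independent {V1 p, V2 p} \<and> span {V1 p, V2 p} = tangent_space M p)"

definition orthogonal_component :: "'a::euclidean_space set \<Rightarrow> 'a \<Rightarrow> 'a" where
  "orthogonal_component T v = (THE u. u \<in> T \<and> (\<forall>w\<in>T. orthogonal (v - u) w))"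

text \<open>Vector fields normal to \<open>M\<close> are given on the ambient space, so the flat connection is
  the ordinary directional derivative. Only values in directions tangent to \<open>M\<close> are used,
  and these depend only on the field along \<open>M\<close>.\<close>

definition connection :: "('a::euclidean_space \<Rightarrow> 'a) \<Rightarrow> 'a \<Rightarrow> 'a \<Rightarrow> 'a" where
  "connection N p X = frechet_derivative N (at p) X"

definition shape_operator :: "'a::euclidean_space set \<Rightarrow> ('a \<Rightarrow> 'a) \<Rightarrow> 'a \<Rightarrow> 'a \<Rightarrow> 'a" where
  "shape_operator M N p X = - orthogonal_component (tangent_space M p) (connection N p X)"

text \<open>The field \<open>\<nu>\<close> is nowhere zero on \<open>M\<close>, but not necessarily unit. The zero vector is
  admitted as a vector tangent to a principal direction.\<close>

definition principal_vector :: "'a::euclidean_space set \<Rightarrow> ('a \<Rightarrow> 'a) \<Rightarrow> 'a \<Rightarrow> 'a \<Rightarrow> bool" where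
  "principal_vector M \<nu> p X \<longleftrightarrow> X \<in> tangent_space M p \<and>
     (\<exists>c::real. shape_operator M (\<lambda>x. \<nu> x /\<^sub>R norm (\<nu> x)) p X = c *\<^sub>R X)"

definition regular_curve_in :: "'a::euclidean_space set \<Rightarrow> real set \<Rightarrow> (real \<Rightarrow> 'a) \<Rightarrow> bool" where
  "regular_curve_in M I \<gamma> \<longleftrightarrow> open I \<and> is_interval I \<and> smooth_on I \<gamma> \<and> \<gamma> ` I \<subseteq> M \<and>
     (\<forall>t\<in>I. vector_derivative \<gamma> (at t) \<noteq> 0)"

definition line_of_curvature ::
  "'a::euclidean_space set \<Rightarrow> ('a \<Rightarrow> 'a) \<Rightarrow> real set \<Rightarrow> (real \<Rightarrow> 'a) \<Rightarrow> bool" where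
  "line_of_curvature M \<nu> I \<gamma> \<longleftrightarrow> regular_curve_in M I \<gamma> \<and>
     (\<forall>t\<in>I. principal_vector M \<nu> (\<gamma> t) (vector_derivative \<gamma> (at t)))"

text \<open>The sign is fixed by lemma \<open>inner_triple_product\<close> below.\<close>

definition triple_product :: "real^4 \<Rightarrow> real^4 \<Rightarrow> real^4 \<Rightarrow> real^4" where
  "triple_product a b c = (\<chi> i. det (vector [a, b, c, axis i 1] :: real^4^4))"

lemma inner_triple_product:
  "triple_product a b c \<bullet> d = det (vector [a, b, c, d] :: real^4^4)"
proof -
  define f where "f = (\<lambda>d. det (vector [a, b, c, d] :: real^4^4))"
  define r where "r = (\<lambda>i. (vector [a, b, c, 0] :: real^4^4) $ i)"
  have f: "f d = det (\<chi> i. if i = 4 then d else r i)" for d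
    unfolding f_def r_def
    by (rule arg_cong[where f = det]) (simp add: vec_eq_iff[where 'a="real^4"] vector_def forall_4)
  have "linear f"
  proof
    show "f (x + y) = f x + f y" for x y
      unfolding f by (rule det_row_add)
    show "f (k *\<^sub>R x) = k *\<^sub>R f x" for k x
      unfolding f using det_row_mul[of 4 k "\<lambda>_. x" r]
      by (simp add: scalar_mult_eq_scaleR cong: if_cong)
  qed
  have "f d = f (\<Sum>i\<in>UNIV. d $ i *\<^sub>R axis i 1)"
    using basis_expansion[of d] by (simp add: scalar_mult_eq_scaleR)
  also have "\<dots> = (\<Sum>i\<in>UNIV. d $ i * f (axis i 1))"
    by (simp add: linear_sum[OF \<open>linear f\<close>] linear_scale[OF \<open>linear f\<close>])
  also have "\<dots> = triple_product a b c \<bullet> d"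
    by (simp add: triple_product_def inner_vec_def f_def mult.commute)
  finally show ?thesis by (simp add: f_def)
qed

definition Omega :: "(real^4 \<Rightarrow> real^4) \<Rightarrow> (real^4 \<Rightarrow> real^4) \<Rightarrow>
    (real^4 \<Rightarrow> real^4) \<Rightarrow> (real^4 \<Rightarrow> real^4) \<Rightarrow> real^4 \<Rightarrow> real" where
  "Omega \<nu> \<mu> V W p = triple_product (connection \<nu> p (V p)) (W p) (\<mu> p) \<bullet> \<nu> p"

end

theory Submission
  imports Defs
begin

text \<open>Let \<open>D\<close> be the derivative of \<open>\<nu>\<close> at \<open>p\<close>. The left-hand side of the equation is
  \<open>det (D X, X, \<mu>, \<nu>)\<close>. Both gradients are orthogonal to the tangent plane and, by
  transversality, linearly independent. If \<open>Y \<noteq> 0\<close> is tangent and orthogonal to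
  \<open>X \<noteq> 0\<close>, then the determinant vanishes iff \<open>D X \<bullet> Y = 0\<close>, i.e. iff the tangential
  component of \<open>D X\<close> is a multiple of \<open>X\<close>. Normalising \<open>\<nu>\<close> only rescales this component,
  because the derivative of the factor contributes a multiple of \<open>\<nu>\<close>.\<close>

section \<open>Determinants of four rows in dimension four\<close>

lemma det_vector_4_linear_1: "linear (\<lambda>x. det (vector [x, b, c, d] :: real^4^4))"
proof -
  \<comment> \<open>The rows are recast as \<open>if i = 1 then x else r i\<close>, the form
    expected by \<open>det_row_add\<close> and \<open>det_row_mul\<close>. The 0 in \<open>r\<close>
    is a placeholder for the varying row and is never read.\<close>
  define r where "r = (\<lambda>i. (vector [0, b, c, d] :: real^4^4) $ i)"
  have f: "det (vector [x, b, c, d] :: real^4^4) = det (\<chi> i. if i = 1 then x else r i)" for x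
    unfolding r_def
    by (rule arg_cong[where f = det]) (simp add: vec_eq_iff[where 'a="real^4"] vector_def forall_4)
  show ?thesis
    unfolding f
  proof
    show "det (\<chi> i. if i = 1 then x + y else r i)
        = det (\<chi> i. if i = 1 then x else r i) + det (\<chi> i. if i = 1 then y else r i)" for x y
      by (rule det_row_add)
    show "det (\<chi> i. if i = 1 then k *\<^sub>R x else r i) = k *\<^sub>R det (\<chi> i. if i = 1 then x else r i)" for k x
      using det_row_mul[of 1 k "\<lambda>_. x" r] by (simp add: scalar_mult_eq_scaleR cong: if_cong)
  qed
qed

lemma det_vector_4_linear_2: "linear (\<lambda>x. det (vector [a, x, c, d] :: real^4^4))"
proof -
  define r where "r = (\<lambda>i. (vector [a, 0, c, d] :: real^4^4) $ i)"
  have f: "det (vector [a, x, c, d] :: real^4^4) = det (\<chi> i. if i = 2 then x else r i)" for x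
    unfolding r_def
    by (rule arg_cong[where f = det]) (simp add: vec_eq_iff[where 'a="real^4"] vector_def forall_4)
  show ?thesis
    unfolding f
  proof
    show "det (\<chi> i. if i = 2 then x + y else r i)
        = det (\<chi> i. if i = 2 then x else r i) + det (\<chi> i. if i = 2 then y else r i)" for x y
      by (rule det_row_add)
    show "det (\<chi> i. if i = 2 then k *\<^sub>R x else r i) = k *\<^sub>R det (\<chi> i. if i = 2 then x else r i)" for k x
      using det_row_mul[of 2 k "\<lambda>_. x" r] by (simp add: scalar_mult_eq_scaleR cong: if_cong)
  qed
qed

text \<open>The entries of the matrix applied to \<open>y\<close> are the inner products of its rows
  with \<open>y\<close>, so \<open>y\<close> is a nonzero kernel vector.\<close>

lemma det_vector_4_eq_0_if_orthogonal:
  fixes y :: "real^4"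
  assumes "y \<noteq> 0" "a \<bullet> y = 0" "b \<bullet> y = 0" "c \<bullet> y = 0" "d \<bullet> y = 0"
  shows "det (vector [a, b, c, d] :: real^4^4) = 0"
proof -
  have "(vector [a, b, c, d] :: real^4^4) *v y = 0"
    using assms(2-) by (simp add: vec_eq_iff forall_4 matrix_vector_mul_component vector_def)
  thus ?thesis
    using \<open>y \<noteq> 0\<close> by (metis det_nz_iff_inj matrix_left_invertible_injective
        matrix_left_invertible_ker invertible_det_nz invertible_left_inverse)
qed

text \<open>A nonzero kernel vector of the transpose lists the coefficients of a linear relation
  between the rows.\<close>

lemma det_vector_4_eq_0_imp_dependent:
  fixes a b c d :: "real^4"
  assumes "det (vector [a, b, c, d] :: real^4^4) = 0"
  obtains k1 k2 k3 k4 :: real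
  where "k1 *\<^sub>R a + k2 *\<^sub>R b + k3 *\<^sub>R c + k4 *\<^sub>R d = 0"
    and "\<not> (k1 = 0 \<and> k2 = 0 \<and> k3 = 0 \<and> k4 = 0)"
proof -
  let ?A = "vector [a, b, c, d] :: real^4^4"
  have "\<not> invertible (transpose ?A)"
    using assms by (simp add: invertible_det_nz)
  then obtain k where k: "transpose ?A *v k = 0" "k \<noteq> 0"
    by (metis invertible_left_inverse matrix_left_invertible_ker)
  have "(\<Sum>i\<in>UNIV. k $ i *\<^sub>R ?A $ i) = 0"
    using k(1) by (simp add: matrix_mult_sum scalar_mult_eq_scaleR row_def column_transpose)
  hence "k $ 1 *\<^sub>R a + k $ 2 *\<^sub>R b + k $ 3 *\<^sub>R c + k $ 4 *\<^sub>R d = 0"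
    by (simp add: sum_4 vector_def)
  moreover have "\<not> (k $ 1 = 0 \<and> k $ 2 = 0 \<and> k $ 3 = 0 \<and> k $ 4 = 0)"
    using k(2) by (simp add: vec_eq_iff forall_4)
  ultimately show thesis by (rule that)
qed

lemma det_vector_4_orthogonal_eq_0_iff:
  fixes x y v m n :: "real^4"
  assumes "x \<noteq> 0" "y \<noteq> 0" "x \<bullet> y = 0"
    and "x \<bullet> m = 0" "x \<bullet> n = 0" "y \<bullet> m = 0" "y \<bullet> n = 0"
    and indep: "\<And>s t. s *\<^sub>R m + t *\<^sub>R n = 0 \<Longrightarrow> s = 0 \<and> t = 0"
  shows "det (vector [v, x, m, n] :: real^4^4) = 0 \<longleftrightarrow> v \<bullet> y = 0"
proof
  assume "v \<bullet> y = 0"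
  thus "det (vector [v, x, m, n] :: real^4^4) = 0"
    using assms by (intro det_vector_4_eq_0_if_orthogonal[of y]) (auto simp: inner_commute)
next
  assume "det (vector [v, x, m, n] :: real^4^4) = 0"
  then obtain k1 k2 k3 k4 where k: "k1 *\<^sub>R v + k2 *\<^sub>R x + k3 *\<^sub>R m + k4 *\<^sub>R n = 0"
    and nz: "\<not> (k1 = 0 \<and> k2 = 0 \<and> k3 = 0 \<and> k4 = 0)"
    by (rule det_vector_4_eq_0_imp_dependent)
  \<comment> \<open>Pairing the relation with \<open>y\<close> removes every term except that of
    \<open>v\<close>.\<close>
  have "k1 * (v \<bullet> y) = 0"
    using arg_cong[OF k, of "\<lambda>z. y \<bullet> z"] assms by (simp add: inner_add_right inner_commute)
  \<comment> \<open>Without the \<open>v\<close> term, pairing with \<open>x\<close> gives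
    \<open>k2 = 0\<close>, and the independence of \<open>m\<close> and \<open>n\<close> then kills
    the whole relation.\<close>
  moreover have "k1 \<noteq> 0"
  proof
    assume "k1 = 0"
    moreover have "k2 = 0"
      using arg_cong[OF k, of "\<lambda>z. x \<bullet> z"] assms \<open>k1 = 0\<close>
      by (simp add: inner_add_right)
    ultimately show False
      using indep[of k3 k4] k nz by auto
  qed
  ultimately show "v \<bullet> y = 0" by simp
qed

section \<open>Orthogonal projection onto a subspace\<close>

lemma orthogonal_component_eqI:
  assumes "subspace T" "u \<in> T" "\<And>w. w \<in> T \<Longrightarrow> orthogonal (v - u) w"
  shows "orthogonal_component T v = u"
  unfolding orthogonal_component_def
proof (rule the_equality)
  fix u' assume u': "u' \<in> T \<and> (\<forall>w\<in>T. orthogonal (v - u') w)"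
  have "u' - u \<in> T" using assms u' by (simp add: subspace_diff)
  hence "(v - u) \<bullet> (u' - u) = 0" "(v - u') \<bullet> (u' - u) = 0"
    using assms(3) u' by (auto simp: orthogonal_def)
  \<comment> \<open>The vector \<open>u' - u\<close> is the difference of \<open>v - u\<close> and
    \<open>v - u'\<close>, both of which are orthogonal to it.\<close>
  hence "(u' - u) \<bullet> (u' - u) = 0" by (simp add: inner_diff_left)
  thus "u' = u" by simp
qed (use assms in auto)

lemma orthogonal_component_span:
  fixes v :: "'a::euclidean_space"
  shows "orthogonal_component (span B) v \<in> span B"
    and "w \<in> span B \<Longrightarrow> (v - orthogonal_component (span B) v) \<bullet> w = 0"
proof -
  obtain y z where yz: "y \<in> span B" "\<And>w. w \<in> span B \<Longrightarrow> orthogonal z w" "v = y + z"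
    using orthogonal_subspace_decomp_exists[of B v] by blast
  have "orthogonal_component (span B) v = y"
    by (rule orthogonal_component_eqI) (use yz in auto)
  thus "orthogonal_component (span B) v \<in> span B"
    and "w \<in> span B \<Longrightarrow> (v - orthogonal_component (span B) v) \<bullet> w = 0"
    using yz by (auto simp: orthogonal_def)
qed

text \<open>This discards the normal term that appears when a normalised field is
  differentiated.\<close>

lemma orthogonal_component_scaleR_add_normal:
  fixes v n :: "'a::euclidean_space"
  assumes "\<And>w. w \<in> span B \<Longrightarrow> n \<bullet> w = 0"
  shows "orthogonal_component (span B) (c *\<^sub>R v + n) = c *\<^sub>R orthogonal_component (span B) v"
proof (rule orthogonal_component_eqI)
  fix w assume w: "w \<in> span B"
  show "orthogonal (c *\<^sub>R v + n - c *\<^sub>R orthogonal_component (span B) v) w"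
    using orthogonal_component_span(2)[OF w, of v] assms[OF w]
    by (simp add: orthogonal_def inner_add_left inner_diff_left)
qed (auto intro: span_scale orthogonal_component_span)

section \<open>Gradients, their differentiability and their normalisation\<close>

lemma frechet_derivative_GDERIV:
  assumes "GDERIV f x :> d"
  shows "frechet_derivative f (at x) v = d \<bullet> v"
  using frechet_derivative_at[of f "\<lambda>h. h \<bullet> d" x] assms
  by (metis gderiv_def inner_commute)

text \<open>Along a curve in \<open>S\<close> the function \<open>f\<close> is constant, so the
  chain rule at 0 gives the claim. Allowing any subset of a level set covers both the level
  hypersurfaces and their intersection.\<close>

lemma GDERIV_orthogonal_tangent_space:
  assumes "GDERIV f p :> d" "v \<in> tangent_space S p" "S \<subseteq> f -` {c}"
  shows "v \<bullet> d = 0"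
proof -
  obtain e \<gamma> where e: "e > 0" "\<gamma> ` {-e<..<e} \<subseteq> S" "\<gamma> 0 = p"
    and \<gamma>: "(\<gamma> has_vector_derivative v) (at 0)"
    using assms(2) unfolding tangent_space_def by blast
  have "(f has_derivative (\<lambda>h. h \<bullet> d)) (at (\<gamma> 0))"
    using assms(1) e by (simp add: gderiv_def)
  hence "((f \<circ> \<gamma>) has_derivative ((\<lambda>h. h \<bullet> d) \<circ> (\<lambda>t. t *\<^sub>R v))) (at 0)"
    using \<gamma> by (intro diff_chain_at) (auto simp: has_vector_derivative_def)
  moreover have "((f \<circ> \<gamma>) has_derivative (\<lambda>_. 0)) (at 0)"
  proof (rule has_derivative_transform_within_open[of "\<lambda>_. c" _ _ _ "{-e<..<e}"])
    show "c = (f \<circ> \<gamma>) x" if "x \<in> {-e<..<e}" for x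
      using that e assms(3) by force
  qed (use e in auto)
  ultimately have "(\<lambda>h. h \<bullet> d) \<circ> (\<lambda>t. t *\<^sub>R v) = (\<lambda>_. 0)"
    by (rule has_derivative_unique)
  from fun_cong[OF this, of 1] show ?thesis by simp
qed

lemma smooth_gradient_differentiable:
  fixes F :: "'a::euclidean_space \<Rightarrow> real"
  assumes "smooth_on UNIV F" and \<nu>: "\<And>x. GDERIV F x :> \<nu> x"
  shows "\<nu> differentiable (at p)"
proof -
  obtain U g where U: "open U" "p \<in> U" "\<And>k. Ck_on_open k U g" "\<And>x. x \<in> U \<Longrightarrow> g x = F x"
    using assms(1) unfolding smooth_on_def by (metis Int_UNIV_left UNIV_I)
  \<comment> \<open>Smoothness only provides a local extension \<open>g\<close>; near
    \<open>p\<close> it agrees with \<open>F\<close>, so its directional derivatives are the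
    components of \<open>\<nu>\<close>.\<close>
  have "(\<lambda>x. \<nu> x \<bullet> v) differentiable (at p)" for v
  proof -
    have "frechet_derivative g (at x) v = \<nu> x \<bullet> v" if "x \<in> U" for x
    proof -
      have "GDERIV g x :> \<nu> x"
        unfolding gderiv_def
        by (rule has_derivative_transform_within_open[OF \<nu>[unfolded gderiv_def] \<open>open U\<close> that])
          (simp add: U)
      thus ?thesis by (rule frechet_derivative_GDERIV)
    qed
    \<comment> \<open>Order two is what makes the first derivatives of \<open>g\<close>
      differentiable in turn.\<close>
    moreover have "(\<lambda>x. frechet_derivative g (at x) v) differentiable (at p)"
      using U(2) U(3)[of "Suc (Suc 0)"] by simp
    ultimately show ?thesis
      by (meson \<open>open U\<close> \<open>p \<in> U\<close> differentiable_def has_derivative_transform_within_open)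
  qed
  thus ?thesis
    by (subst differentiable_componentwise_within) auto
qed

text \<open>By the product rule, \<open>k\<close> is the derivative of the reciprocal norm in
  direction \<open>X\<close>. Later it matters only that this term is a multiple of
  \<open>\<nu> p\<close>, hence normal.\<close>

lemma frechet_derivative_normalize:
  fixes \<nu> :: "'a::euclidean_space \<Rightarrow> 'a"
  assumes "\<nu> differentiable (at p)" "\<nu> p \<noteq> 0"
  obtains k where "frechet_derivative (\<lambda>x. \<nu> x /\<^sub>R norm (\<nu> x)) (at p) X
      = inverse (norm (\<nu> p)) *\<^sub>R frechet_derivative \<nu> (at p) X + k *\<^sub>R \<nu> p"
proof -
  have "(\<lambda>x. norm (\<nu> x)) differentiable (at p)"
    using differentiable_chain_at[OF assms(1) differentiable_norm_at[OF assms(2)]]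
    by (simp add: o_def)
  hence "(\<lambda>x. inverse (norm (\<nu> x))) differentiable (at p)"
    using assms by (intro differentiable_inverse) auto
  then obtain h where h: "((\<lambda>x. inverse (norm (\<nu> x))) has_derivative h) (at p)"
    by (auto simp: differentiable_def)
  have "((\<lambda>x. \<nu> x /\<^sub>R norm (\<nu> x)) has_derivative
      (\<lambda>X. inverse (norm (\<nu> p)) *\<^sub>R frechet_derivative \<nu> (at p) X + h X *\<^sub>R \<nu> p)) (at p)"
    using has_derivative_scaleR[OF h] assms(1) by (simp add: frechet_derivative_works)
  from fun_cong[OF frechet_derivative_at[OF this], of X] show thesis
    by (intro that[of "h X"]) simp
qed

section \<open>Orthogonal directions in a plane\<close>

lemma plane_orthogonal_vectors:
  fixes v w x :: "'a::euclidean_space"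
  assumes "v \<noteq> w" "independent {v, w}" "x \<in> span {v, w}" "x \<noteq> 0"
  obtains y where "y \<in> span {v, w}" "y \<noteq> 0" "x \<bullet> y = 0"
    and "\<And>u. u \<in> span {v, w} \<Longrightarrow> u \<bullet> y = 0 \<Longrightarrow> \<exists>c. u = c *\<^sub>R x"
proof -
  \<comment> \<open>The coefficients are chosen so that the two contributions to
    \<open>x \<bullet> y\<close> cancel.\<close>
  define y where "y = (x \<bullet> w) *\<^sub>R v - (x \<bullet> v) *\<^sub>R w"
  have y: "y \<in> span {v, w}"
    unfolding y_def by (intro span_diff span_scale span_base) auto
  have xy: "x \<bullet> y = 0"
    by (simp add: y_def inner_diff_right)
  have "y \<noteq> 0"
  proof
    assume "y = 0"
    \<comment> \<open>If \<open>y\<close> vanished, independence of \<open>v\<close> and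
      \<open>w\<close> would force both coefficients to be zero; then \<open>x\<close> would be
      orthogonal to the plane containing it.\<close>
    have "x \<bullet> w = 0 \<and> x \<bullet> v = 0"
    proof (rule ccontr)
      assume nz: "\<not> ?thesis"
      have eq: "(x \<bullet> w) *\<^sub>R v = (x \<bullet> v) *\<^sub>R w"
        using \<open>y = 0\<close> by (simp add: y_def)
      have "v \<noteq> 0" "w \<noteq> 0" using assms(2) dependent_zero by blast+
      hence "x \<bullet> w \<noteq> 0" using nz eq by auto
      hence "v = ((x \<bullet> v) / (x \<bullet> w)) *\<^sub>R w"
        using eq by (metis divide_inverse_commute scaleR_scaleR left_inverse scaleR_one)
      hence "v \<in> span {w}" by (metis span_base span_scale singletonI)
      thus False using assms(1,2) by (simp add: independent_insert)
    qed
    hence "orthogonal x z" if "z \<in> {v, w}" for z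
      using that by (auto simp: orthogonal_def)
    hence "orthogonal x x"
      using assms(3) by (metis orthogonal_to_span orthogonal_commute)
    thus False using assms(4) by (simp add: orthogonal_def)
  qed
  have "\<exists>c. u = c *\<^sub>R x" if u: "u \<in> span {v, w}" "u \<bullet> y = 0" for u
  proof -
    have "x \<noteq> y" using xy \<open>x \<noteq> 0\<close> by auto
    have "independent {x, y}"
      by (rule pairwise_orthogonal_independent)
        (use xy \<open>x \<noteq> 0\<close> \<open>y \<noteq> 0\<close> in \<open>auto simp: pairwise_def orthogonal_def inner_commute\<close>)
    \<comment> \<open>By dimension count, the orthogonal pair \<open>x\<close>, \<open>y\<close>
      spans the plane, so a vector of the plane orthogonal to \<open>y\<close> has only an
      \<open>x\<close> component.\<close>
    moreover have "dim (span {v, w}) \<le> card {x, y}"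
      using \<open>x \<noteq> y\<close> assms(1) dim_le_card'[of "{v, w}"] by simp
    ultimately have "span {v, w} \<subseteq> span {x, y}"
      using y assms(3) card_ge_dim_independent[of "{x, y}" "span {v, w}"] by auto
    then obtain c k where "u = c *\<^sub>R x + k *\<^sub>R y"
      using u(1) by (force simp: span_insert span_singleton algebra_simps)
    moreover have "k = 0"
      using calculation u(2) xy \<open>y \<noteq> 0\<close> by (simp add: inner_add_left)
    ultimately show ?thesis by auto
  qed
  with y \<open>y \<noteq> 0\<close> xy show thesis by (rule that)
qed

section \<open>Independence of the two gradients\<close>

lemma regular_value_gradient_nonzero:
  assumes "regular_value F a" "GDERIV F p :> d" "F p = a"
  shows "d \<noteq> 0"
proof
  assume "d = 0"
  hence "frechet_derivative F (at p) v = 0" for v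
    using frechet_derivative_GDERIV[OF assms(2)] by simp
  moreover have "surj (frechet_derivative F (at p))"
    using assms by (simp add: regular_value_def)
  ultimately show False
    by (metis surjD zero_neq_one)
qed

text \<open>If the nonzero gradients were parallel, both tangent spaces would lie in the hyperplane
  orthogonal to \<open>n\<close>, so their sum could not contain \<open>n\<close>.\<close>

lemma transversal_gradients_independent:
  assumes "regular_value F a" "regular_value G b"
    and "transversal (F -` {a}) (G -` {b})" "F p = a" "G p = b"
    and dF: "GDERIV F p :> n" and dG: "GDERIV G p :> m"
    and st: "s *\<^sub>R m + t *\<^sub>R n = 0"
  shows "s = 0 \<and> t = 0"
proof (rule ccontr)
  assume nz: "\<not> ?thesis"
  have "n \<noteq> 0" "m \<noteq> 0"
    using regular_value_gradient_nonzero assms by blast+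
  hence "s \<noteq> 0" using nz st by auto
  \<comment> \<open>Transversality is applied to the vector \<open>n\<close> itself.\<close>
  obtain u v where uv: "n = u + v"
    "u \<in> tangent_space (F -` {a}) p" "v \<in> tangent_space (G -` {b}) p"
    using assms(3-5) unfolding transversal_def by blast
  have un: "u \<bullet> n = 0" and vm: "v \<bullet> m = 0"
    using GDERIV_orthogonal_tangent_space[OF dF uv(2)] GDERIV_orthogonal_tangent_space[OF dG uv(3)]
    by auto
  have "t * (v \<bullet> n) = 0"
    using arg_cong[OF st, of "\<lambda>z. v \<bullet> z"] vm by (simp add: inner_add_right)
  moreover have "t \<noteq> 0" using st \<open>s \<noteq> 0\<close> \<open>m \<noteq> 0\<close> by auto
  ultimately have "n \<bullet> n = 0"
    using un uv(1) by (metis add.right_neutral inner_add_left mult_eq_0_iff)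
  thus False using \<open>n \<noteq> 0\<close> by simp
qed

section \<open>Principal vectors and the quadratic equation\<close>

lemma principal_vector_iff_det:
  fixes \<nu> :: "real^4 \<Rightarrow> real^4"
  assumes "\<nu> differentiable (at p)" "v \<noteq> w" "independent {v, w}"
    and T: "tangent_space M p = span {v, w}"
    and normal: "\<And>x. x \<in> span {v, w} \<Longrightarrow> x \<bullet> \<nu> p = 0" "\<And>x. x \<in> span {v, w} \<Longrightarrow> x \<bullet> m = 0"
    and indep: "\<And>s t. s *\<^sub>R m + t *\<^sub>R \<nu> p = 0 \<Longrightarrow> s = 0 \<and> t = 0"
    and X: "X \<in> span {v, w}"
  shows "principal_vector M \<nu> p X \<longleftrightarrow>
    det (vector [connection \<nu> p X, X, m, \<nu> p] :: real^4^4) = 0"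
proof -
  have nz: "\<nu> p \<noteq> 0"
    using indep[of 0 1] by auto
  define P where "P = orthogonal_component (span {v, w}) (connection \<nu> p X)"
  have P: "P \<in> span {v, w}" "\<And>u. u \<in> span {v, w} \<Longrightarrow> P \<bullet> u = connection \<nu> p X \<bullet> u"
    using orthogonal_component_span[where B = "{v, w}" and v = "connection \<nu> p X"]
    by (simp_all add: P_def inner_diff_left)
  obtain k where k: "frechet_derivative (\<lambda>x. \<nu> x /\<^sub>R norm (\<nu> x)) (at p) X
      = inverse (norm (\<nu> p)) *\<^sub>R connection \<nu> p X + k *\<^sub>R \<nu> p"
    unfolding connection_def using frechet_derivative_normalize[OF assms(1) nz] by blast
  have "shape_operator M (\<lambda>x. \<nu> x /\<^sub>R norm (\<nu> x)) p X = - (inverse (norm (\<nu> p)) *\<^sub>R P)"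
    unfolding shape_operator_def T P_def
    unfolding connection_def[of "\<lambda>x. \<nu> x /\<^sub>R norm (\<nu> x)"] k
    using normal(1) by (subst orthogonal_component_scaleR_add_normal) (auto simp: inner_commute)
  \<comment> \<open>The factor is nonzero, so it can be absorbed into the eigenvalue.\<close>
  moreover have "(\<exists>c. - (inverse (norm (\<nu> p)) *\<^sub>R P) = c *\<^sub>R X) \<longleftrightarrow> (\<exists>c. P = c *\<^sub>R X)"
  proof safe
    fix c assume "- (inverse (norm (\<nu> p)) *\<^sub>R P) = c *\<^sub>R X"
    from arg_cong[OF this, of "\<lambda>z. (- norm (\<nu> p)) *\<^sub>R z"] nz
    show "\<exists>c. P = c *\<^sub>R X" by (intro exI[of _ "- norm (\<nu> p) * c"]) simp
  next
    fix c assume "P = c *\<^sub>R X"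
    thus "\<exists>c'. - (inverse (norm (\<nu> p)) *\<^sub>R c *\<^sub>R X) = c' *\<^sub>R X"
      by (metis scaleR_minus_left scaleR_scaleR)
  qed
  ultimately have "principal_vector M \<nu> p X \<longleftrightarrow> (\<exists>c. P = c *\<^sub>R X)"
    using X by (simp add: principal_vector_def T)
  also have "\<dots> \<longleftrightarrow> det (vector [connection \<nu> p X, X, m, \<nu> p] :: real^4^4) = 0"
  proof (cases "X = 0")
    \<comment> \<open>For the zero vector both sides hold: \<open>P\<close> is zero and so is the
      second row.\<close>
    case True
    have "linear (frechet_derivative \<nu> (at p))"
      using assms(1) by (rule linear_frechet_derivative)
    hence "P = 0"
      using True P by (metis connection_def inner_eq_zero_iff inner_zero_left linear_0)
    thus ?thesis
      using True linear_0[OF det_vector_4_linear_2] by auto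
  next
    case False
    obtain y where y: "y \<in> span {v, w}" "y \<noteq> 0" "X \<bullet> y = 0"
      and mult: "\<And>u. u \<in> span {v, w} \<Longrightarrow> u \<bullet> y = 0 \<Longrightarrow> \<exists>c. u = c *\<^sub>R X"
      using plane_orthogonal_vectors[OF assms(2,3) X False] by blast
    have "(\<exists>c. P = c *\<^sub>R X) \<longleftrightarrow> P \<bullet> y = 0"
      using mult[OF P(1)] y by auto
    \<comment> \<open>\<open>P\<close> and the full derivative differ by a vector orthogonal to the
      plane, which contains \<open>y\<close>.\<close>
    also have "\<dots> \<longleftrightarrow> connection \<nu> p X \<bullet> y = 0"
      using P(2) y by simp
    also have "\<dots> \<longleftrightarrow> det (vector [connection \<nu> p X, X, m, \<nu> p] :: real^4^4) = 0"
      using y False X normal indep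
      by (intro det_vector_4_orthogonal_eq_0_iff[symmetric]) auto
    finally show ?thesis .
  qed
  finally show ?thesis .
qed

text \<open>Since the derivative of \<open>\<nu>\<close> is linear, the determinant is bilinear in
  the vectors put into its first two rows; expanding gives the four \<open>Omega\<close>
  terms.\<close>

lemma Omega_quadratic_form:
  fixes x y :: real
  assumes "\<nu> differentiable (at p)"
  shows "det (vector [connection \<nu> p (x *\<^sub>R V p + y *\<^sub>R W p), x *\<^sub>R V p + y *\<^sub>R W p, \<mu> p, \<nu> p] :: real^4^4)
    = x\<^sup>2 * Omega \<nu> \<mu> V V p + x * y * (Omega \<nu> \<mu> V W p + Omega \<nu> \<mu> W V p) + y\<^sup>2 * Omega \<nu> \<mu> W W p"
proof -
  have "linear (connection \<nu> p)"
    unfolding connection_def using assms by (rule linear_frechet_derivative)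
  thus ?thesis
    unfolding Omega_def inner_triple_product
    by (simp add: linear_add linear_scale linear_add[OF det_vector_4_linear_1]
        linear_scale[OF det_vector_4_linear_1] linear_add[OF det_vector_4_linear_2]
        linear_scale[OF det_vector_4_linear_2] power2_eq_square algebra_simps)
qed

theorem corollary2p5:
  fixes F G :: "real^4 \<Rightarrow> real"
    and a b :: real
    and M :: "(real^4) set"
    and \<nu> \<mu> V1 V2 :: "real^4 \<Rightarrow> real^4"
  assumes "smooth_on UNIV F" and "smooth_on UNIV G"
    and "regular_value F a" and "regular_value G b"
    and "transversal (F -` {a}) (G -` {b})"
    and "M = F -` {a} \<inter> G -` {b}"
    and "\<And>x. GDERIV F x :> \<nu> x" and "\<And>x. GDERIV G x :> \<mu> x"
    and "tangent_frame M V1 V2"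
  shows "(\<forall>p\<in>M. \<forall>l1 l2 :: real.
            principal_vector M \<nu> p (l1 *\<^sub>R V1 p + l2 *\<^sub>R V2 p) \<longleftrightarrow>
            l1\<^sup>2 * Omega \<nu> \<mu> V1 V1 p
              + l1 * l2 * (Omega \<nu> \<mu> V1 V2 p + Omega \<nu> \<mu> V2 V1 p)
              + l2\<^sup>2 * Omega \<nu> \<mu> V2 V2 p = 0) \<and>
         (\<forall>I \<gamma> l1 l2. regular_curve_in M I \<gamma> \<and>
            (\<forall>t\<in>I. vector_derivative \<gamma> (at t) = l1 t *\<^sub>R V1 (\<gamma> t) + l2 t *\<^sub>R V2 (\<gamma> t)) \<longrightarrow>
            (line_of_curvature M \<nu> I \<gamma> \<longleftrightarrow>
             (\<forall>t\<in>I. (l1 t)\<^sup>2 * Omega \<nu> \<mu> V1 V1 (\<gamma> t)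
                 + (l1 t) * (l2 t) * (Omega \<nu> \<mu> V1 V2 (\<gamma> t) + Omega \<nu> \<mu> V2 V1 (\<gamma> t))
                 + (l2 t)\<^sup>2 * Omega \<nu> \<mu> V2 V2 (\<gamma> t) = 0)))"
proof -
  have eq: "principal_vector M \<nu> p (l1 *\<^sub>R V1 p + l2 *\<^sub>R V2 p) \<longleftrightarrow>
      l1\<^sup>2 * Omega \<nu> \<mu> V1 V1 p + l1 * l2 * (Omega \<nu> \<mu> V1 V2 p + Omega \<nu> \<mu> V2 V1 p)
        + l2\<^sup>2 * Omega \<nu> \<mu> V2 V2 p = 0" if p: "p \<in> M" for p and l1 l2 :: real
  proof -
    have diff: "\<nu> differentiable (at p)"
      using smooth_gradient_differentiable assms(1,7) by blast
    have FG: "F p = a" "G p = b"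
      using p assms(6) by auto
    have V: "V1 p \<noteq> V2 p" "independent {V1 p, V2 p}" "tangent_space M p = span {V1 p, V2 p}"
      using assms(9) p by (auto simp: tangent_frame_def)
    show ?thesis
      unfolding Omega_quadratic_form[OF diff, symmetric]
    proof (rule principal_vector_iff_det[OF diff V])
      show "x \<bullet> \<nu> p = 0" "x \<bullet> \<mu> p = 0" if "x \<in> span {V1 p, V2 p}" for x
        using that GDERIV_orthogonal_tangent_space[OF assms(7), of x M p a]
          GDERIV_orthogonal_tangent_space[OF assms(8), of x M p b] V(3) assms(6) by auto
      show "s = 0 \<and> t = 0" if "s *\<^sub>R \<mu> p + t *\<^sub>R \<nu> p = 0" for s t
        using transversal_gradients_independent[OF assms(3-5) FG assms(7,8) that] .
      show "l1 *\<^sub>R V1 p + l2 *\<^sub>R V2 p \<in> span {V1 p, V2 p}"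
        by (intro span_add span_scale span_base) auto
    qed
  qed
  \<comment> \<open>The statement for curves is the pointwise equivalence at each
    \<open>\<gamma> t\<close>, with the velocity expanded in the frame.\<close>
  have "line_of_curvature M \<nu> I \<gamma> \<longleftrightarrow>
      (\<forall>t\<in>I. (l1 t)\<^sup>2 * Omega \<nu> \<mu> V1 V1 (\<gamma> t)
        + (l1 t) * (l2 t) * (Omega \<nu> \<mu> V1 V2 (\<gamma> t) + Omega \<nu> \<mu> V2 V1 (\<gamma> t))
        + (l2 t)\<^sup>2 * Omega \<nu> \<mu> V2 V2 (\<gamma> t) = 0)"
    if "regular_curve_in M I \<gamma>"
      and "\<forall>t\<in>I. vector_derivative \<gamma> (at t) = l1 t *\<^sub>R V1 (\<gamma> t) + l2 t *\<^sub>R V2 (\<gamma> t)"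
    for I \<gamma> l1 l2
  proof -
    have "\<gamma> t \<in> M" if "t \<in> I" for t
      using \<open>regular_curve_in M I \<gamma>\<close> that by (auto simp: regular_curve_in_def)
    with that show ?thesis
      unfolding line_of_curvature_def by (simp add: eq)
  qed
  with eq show ?thesis by blast
qed

end
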